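(* Let $n$ be odd and let $\epsilon>0$ be small. Let $L_n$ be the Laplacian of the path graph $P_n$ and $\tilde L_n:=L_n+\epsilon e_{p^*}e_{p^*}^T$ with $p^*=\frac{n+1}{2}$. Let $L_{2n}$ be the Laplacian of $P_{2n}$ and $\overset{\approx}{L}_{2n}:=L_{2n}+\epsilon\big(e_{q_1}e_{q_1}^T+e_{q_2}e_{q_2}^T\big)$ with $q_1=\frac{2n+2}{4}=\frac{n+1}{2}$ and $q_2=\frac{6n+2}{4}=\frac{3n+1}{2}$ (the centers of the two halves of $P_{2n}$). Then $\lambda_{\min}(\tilde L_n)=\lambda_{\min}(\overset{\approx}{L}_{2n})$.
   Context: $e_j$ denotes the $j$-th standard basis column vector of the appropriate dimension. The path Laplacian $L_m$ is tridiagonal with diagonal $(1,2,\dots,2,1)$ and sub/super-diagonal entries $-1$. *)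

theory Defs
  imports "Jordan_Normal_Form.Spectral_Radius"
begin

text \<open>Vertices of the path \<open>P\<^sub>m\<close> are \<open>0, \<dots>, m - 1\<close>, matching the matrix indices.\<close>

definition path_adj :: "nat \<Rightarrow> nat \<Rightarrow> nat \<Rightarrow> bool" where
  "path_adj m i j \<longleftrightarrow> i < m \<and> j < m \<and> (j = Suc i \<or> i = Suc j)"

definition path_laplacian :: "nat \<Rightarrow> real mat" where
  "path_laplacian m = Matrix.mat m m (\<lambda>(i, j).
     if i = j then real (card {k. path_adj m i k})
     else if path_adj m i j then - 1 else 0)"

text \<open>For \<open>m \<ge> 2\<close> this is the tridiagonal matrix with diagonal \<open>(1, 2, \<dots>, 2, 1)\<close>; for \<open>m = 1\<close>,
  where that pattern is degenerate, the Laplacian is the zero matrix.\<close>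

lemma path_laplacian_tridiagonal:
  assumes "2 \<le> m"
  shows "path_laplacian m = Matrix.mat m m (\<lambda>(i, j).
    if i = j then (if i = 0 \<or> i = m - 1 then 1 else 2)
    else if j = Suc i \<or> i = Suc j then - 1 else 0)"
proof -
  have deg: "card (Collect (path_adj m i)) = (if i = 0 \<or> i = m - 1 then 1 else 2)" if i: "i < m" for i
  proof -
    consider "i = 0" | "0 < i" "i = m - 1" | "0 < i" "i < m - 1"
      using i by linarith
    then show ?thesis
    proof cases
      case 1
      then have "{k. path_adj m i k} = {1}"
        using assms by (auto simp: path_adj_def)
      with 1 show ?thesis by simp
    next
      case 2
      then have "{k. path_adj m i k} = {i - 1}"
        using assms by (auto simp: path_adj_def)
      with 2 show ?thesis by simp
    next
      case 3
      then have "{k. path_adj m i k} = {i - 1, Suc i}"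
        by (auto simp: path_adj_def)
      with 3 show ?thesis by simp
    qed
  qed
  show ?thesis
    unfolding path_laplacian_def
    by (intro eq_matI) (simp_all add: deg, simp_all add: path_adj_def)
qed

lemma path_laplacian_1: "path_laplacian 1 = 0\<^sub>m 1 1"
proof -
  have "path_adj (Suc 0) 0 = (\<lambda>_. False)"
    by (auto simp: path_adj_def)
  then show ?thesis
    unfolding path_laplacian_def by (intro eq_matI) simp_all
qed

text \<open>The position \<open>j\<close> is counted from 1, hence the shift.\<close>

definition std_basis_col :: "nat \<Rightarrow> nat \<Rightarrow> real mat" where
  "std_basis_col m j = mat_of_cols m [unit_vec m (j - 1)]"

text \<open>Intended for real symmetric matrices of positive size, whose real spectrum is finite and
  nonempty.\<close>

definition lambda_min :: "real mat \<Rightarrow> real" where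
  "lambda_min A = Min (spectrum A)"

definition path_laplacian_centered :: "nat \<Rightarrow> real \<Rightarrow> real mat" where
  "path_laplacian_centered n \<epsilon> =
     (let e = std_basis_col n ((n + 1) div 2)
      in path_laplacian n + \<epsilon> \<cdot>\<^sub>m (e * transpose_mat e))"

definition path_laplacian_two_centers :: "nat \<Rightarrow> real \<Rightarrow> real mat" where
  "path_laplacian_two_centers n \<epsilon> =
     (let e1 = std_basis_col (2 * n) ((2 * n + 2) div 4);
          e2 = std_basis_col (2 * n) ((6 * n + 2) div 4)
      in path_laplacian (2 * n) + \<epsilon> \<cdot>\<^sub>m (e1 * transpose_mat e1 + e2 * transpose_mat e2))"

lemma center_positions:
  assumes "odd (n :: nat)"
  shows "2 * ((n + 1) div 2) = n + 1"
    and "4 * ((2 * n + 2) div 4) = 2 * n + 2" and "(2 * n + 2) div 4 = (n + 1) div 2"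
    and "4 * ((6 * n + 2) div 4) = 6 * n + 2" and "(6 * n + 2) div 4 = (3 * n + 1) div 2"
  using assms by (auto elim!: oddE)

end

theory Submission
  imports Defs "HOL-Analysis.Function_Topology"
begin

text \<open>Cutting the middle edge of \<open>P\<^sub>2\<^sub>n\<close> leaves two copies of \<open>P\<^sub>n\<close>, each perturbed at its
  centre, so the quadratic form of the large matrix at \<open>(y, z)\<close> is the sum of the forms of the small
  one at \<open>y\<close> and at \<open>z\<close>, plus the square \<open>(y\<^sub>n - z\<^sub>1)\<^sup>2\<close> contributed by the cut edge. By the Rayleigh
  principle no eigenvalue of the large matrix is below the least eigenvalue of the small one.
  Conversely, an eigenvector \<open>y\<close> of the small matrix followed by its mirror image is an eigenvector of
  the large one: the small matrix is invariant under the reflection of the path, and the cut edge does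
  not contribute because its two endpoints carry the same value.\<close>

section \<open>The Rayleigh principle for real symmetric matrices\<close>

lemma scalar_prod_self_real:
  fixes x :: "real Matrix.vec"
  shows "x \<bullet> x = (\<Sum>i<dim_vec x. (x $ i)\<^sup>2)"
  by (simp add: scalar_prod_def power2_eq_square atLeast0LessThan)

lemma scalar_prod_self_pos:
  fixes x :: "real Matrix.vec"
  assumes "x \<in> carrier_vec n" "x \<noteq> 0\<^sub>v n"
  shows "0 < x \<bullet> x"
proof -
  obtain i where "i < n" "x $ i \<noteq> 0"
    using assms by (metis carrier_vecD eq_vecI index_zero_vec)
  then show ?thesis
    using assms by (auto simp: scalar_prod_self_real intro!: sum_pos2[where i = i])
qed

text \<open>Encoding vectors as functions that vanish from \<open>n\<close> on allows an arbitrary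
  dimension while keeping compactness: coordinates below \<open>n\<close> range over [-1, 1], the
  others over {0}, so Tychonoff makes the box compact, and the sphere is a closed subset of
  it.\<close>

lemma unit_sphere_attains_min:
  fixes q :: "(nat \<Rightarrow> real) \<Rightarrow> real"
  assumes "0 < n" and "continuous_on UNIV q"
  defines "S \<equiv> {f. (\<forall>i\<ge>n. f i = 0) \<and> (\<Sum>i<n. (f i)\<^sup>2) = 1}"
  shows "\<exists>f\<in>S. \<forall>g\<in>S. q f \<le> q g"
proof -
  let ?box = "PiE UNIV (\<lambda>i. if i < n then {-1..1::real} else {0})"
  have "compactin (product_topology (\<lambda>i. euclidean) UNIV) ?box"
    by (subst compactin_PiE) auto
  then have box: "compact ?box"
    by (simp add: euclidean_product_topology)
  have "closed {f. (\<Sum>i<n. (f i)\<^sup>2) = (1::real)}"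
    by (intro closed_Collect_eq continuous_intros) simp_all
  with box have "compact (?box \<inter> {f. (\<Sum>i<n. (f i)\<^sup>2) = 1})"
    by (rule compact_Int_closed)
  moreover have "S = ?box \<inter> {f. (\<Sum>i<n. (f i)\<^sup>2) = 1}"
  proof -
    have "\<bar>f i\<bar> \<le> 1" if "(\<Sum>i<n. (f i)\<^sup>2) = 1" "i < n" for f :: "nat \<Rightarrow> real" and i
    proof -
      have "(f i)\<^sup>2 \<le> (\<Sum>i<n. (f i)\<^sup>2)"
        using that by (intro member_le_sum) auto
      then show ?thesis
        using that by (simp add: abs_square_le_1)
    qed
    then have "f \<in> ?box \<longleftrightarrow> (\<forall>i\<ge>n. f i = 0)" if "(\<Sum>i<n. (f i)\<^sup>2) = 1" for f :: "nat \<Rightarrow> real"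
      using that by (simp add: PiE_iff abs_le_iff minus_le_iff) (meson linorder_not_le)
    then show ?thesis
      unfolding S_def by blast
  qed
  moreover have "(\<lambda>i. if i = 0 then 1 else 0) \<in> S"
    using assms(1) by (simp add: S_def if_distrib[of "\<lambda>x. x\<^sup>2"] cong: if_cong)
  ultimately show ?thesis
    using continuous_attains_inf[of S q] continuous_on_subset[OF assms(2)] by auto
qed

text \<open>The vector \<open>v\<close> minimises a nonnegative form, so the first variation
  vanishes in every direction. In the direction \<open>M *\<^sub>v v\<close> that variation is twice
  the squared norm of \<open>M *\<^sub>v v\<close>.\<close>

lemma psd_mult_vec_eq_0:
  fixes M :: "real mat"
  assumes M: "M \<in> carrier_mat n n" and sym: "transpose_mat M = M"
    and psd: "\<And>x. x \<in> carrier_vec n \<Longrightarrow> 0 \<le> x \<bullet> (M *\<^sub>v x)"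
    and v: "v \<in> carrier_vec n" and "v \<bullet> (M *\<^sub>v v) = 0"
  shows "M *\<^sub>v v = 0\<^sub>v n"
proof (rule ccontr)
  assume neq: "M *\<^sub>v v \<noteq> 0\<^sub>v n"
  define w where "w = M *\<^sub>v v"
  have w: "w \<in> carrier_vec n"
    using M v by (simp add: w_def)
  have Mw: "M *\<^sub>v w \<in> carrier_vec n"
    using M w by simp
  have vMw: "v \<bullet> (M *\<^sub>v w) = w \<bullet> w"
    using transpose_vec_mult_scalar[OF M w v] by (simp add: sym w_def)
  have pos: "0 < w \<bullet> w"
    using scalar_prod_self_pos[OF w] neq by (simp add: w_def)
  have quad: "0 \<le> 2 * t * (w \<bullet> w) + t\<^sup>2 * (w \<bullet> (M *\<^sub>v w))" for t
  proof -
    have "M *\<^sub>v (v + t \<cdot>\<^sub>v w) = w + t \<cdot>\<^sub>v (M *\<^sub>v w)"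
      using M v w by (simp add: mult_add_distrib_mat_vec[where nr = n and nc = n] mult_mat_vec w_def)
    then have "(v + t \<cdot>\<^sub>v w) \<bullet> (M *\<^sub>v (v + t \<cdot>\<^sub>v w)) =
        v \<bullet> w + t * (w \<bullet> w) + t * (v \<bullet> (M *\<^sub>v w)) + t\<^sup>2 * (w \<bullet> (M *\<^sub>v w))"
      using v w Mw
      by (simp add: scalar_prod_add_distrib[where n = n] add_scalar_prod_distrib[where n = n]
          algebra_simps power2_eq_square)
    moreover have "v \<bullet> w = 0"
      using assms(5) by (simp add: w_def)
    ultimately show ?thesis
      using psd[of "v + t \<cdot>\<^sub>v w"] v w vMw by simp
  qed
  define c where "c = w \<bullet> (M *\<^sub>v w)"
  have c: "0 \<le> c"
    using psd[OF w] by (simp add: c_def)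
  \<comment> \<open>For \<open>c > 0\<close> the quadratic in \<open>t\<close> is minimal at
    \<open>- (w \<bullet> w) / c\<close>. Dividing by \<open>c + 1\<close> instead still gives a
    negative value and remains meaningful when \<open>c = 0\<close>.\<close>
  define t where "t = - (w \<bullet> w) / (c + 1)"
  have t: "t * (c + 1) = - (w \<bullet> w)" "t < 0"
    using c pos by (auto simp: t_def divide_neg_pos)
  have "2 * t * (w \<bullet> w) + t\<^sup>2 * c = t * (2 * (w \<bullet> w) + t * (c + 1) - t)"
    by (simp add: algebra_simps power2_eq_square)
  also have "\<dots> = t * ((w \<bullet> w) - t)"
    by (simp add: t)
  also have "\<dots> < 0"
    using t pos by (simp add: mult_neg_pos)
  finally show False
    using quad[of t] by (simp add: c_def)
qed

text \<open>The minimum \<open>k\<close> of the form on the unit sphere bounds it everywhere by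
  homogeneity. Hence A - k I is positive semidefinite with form zero at the minimiser
  \<open>v\<close>, which therefore lies in its kernel.\<close>

lemma rayleigh_minimum:
  fixes A :: "real mat"
  assumes A: "A \<in> carrier_mat n n" and "0 < n" and sym: "transpose_mat A = A"
  obtains v k where "eigenvector A v k" "\<And>x. x \<in> carrier_vec n \<Longrightarrow> k * (x \<bullet> x) \<le> x \<bullet> (A *\<^sub>v x)"
proof -
  define q where "q f = (\<Sum>i<n. f i * (\<Sum>j<n. A $$ (i, j) * f j))" for f :: "nat \<Rightarrow> real"
  \<comment> \<open>Entries outside the dimension are unspecified; setting them to 0 places the
    coordinates in the function space where the sphere is compact.\<close>
  have q: "x \<bullet> (A *\<^sub>v x) = q (\<lambda>i. if i < n then x $ i else 0)" if "x \<in> carrier_vec n" for x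
    using A that by (auto simp: q_def scalar_prod_def atLeast0LessThan intro!: sum.cong)
  have "continuous_on UNIV q"
    unfolding q_def by (intro continuous_intros) simp_all
  from unit_sphere_attains_min[OF \<open>0 < n\<close> this] obtain f where f: "\<forall>i\<ge>n. f i = 0"
      "(\<Sum>i<n. (f i)\<^sup>2) = 1"
    and min: "\<And>g. \<forall>i\<ge>n. g i = 0 \<Longrightarrow> (\<Sum>i<n. (g i)\<^sup>2) = 1 \<Longrightarrow> q f \<le> q g"
    by auto
  define v where "v = Matrix.vec n f"
  define k where "k = q f"
  have v: "v \<in> carrier_vec n" "v \<bullet> v = 1"
    using f by (auto simp: v_def scalar_prod_self_real)
  have "(\<lambda>i. if i < n then v $ i else 0) = f"
    using f by (auto simp: v_def)
  then have vAv: "v \<bullet> (A *\<^sub>v v) = k"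
    using q[OF v(1)] by (simp add: k_def)
  have bound: "k * (x \<bullet> x) \<le> x \<bullet> (A *\<^sub>v x)" if x: "x \<in> carrier_vec n" for x
  proof (cases "x = 0\<^sub>v n")
    case True
    then show ?thesis
      using A by simp
  next
    case False
    define s where "s = sqrt (x \<bullet> x)"
    have s: "0 < s" "s\<^sup>2 = x \<bullet> x"
      using scalar_prod_self_pos[OF x False] by (auto simp: s_def)
    define y where "y = (1 / s) \<cdot>\<^sub>v x"
    have y: "y \<in> carrier_vec n"
      using x by (simp add: y_def)
    have "y \<bullet> y = 1"
      using x s(1) s(2)[symmetric] by (simp add: y_def power2_eq_square)
    then have "k \<le> y \<bullet> (A *\<^sub>v y)"
      using y unfolding q[OF y] k_def by (intro min) (auto simp: scalar_prod_self_real)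
    also have "\<dots> = (x \<bullet> (A *\<^sub>v x)) / s\<^sup>2"
      using A x by (simp add: y_def mult_mat_vec power2_eq_square
          scalar_prod_smult_left scalar_prod_smult_right)
    finally show ?thesis
      using s(1) unfolding s(2)[symmetric] by (simp add: pos_le_divide_eq)
  qed
  define M where "M = A - k \<cdot>\<^sub>m 1\<^sub>m n"
  have M: "M \<in> carrier_mat n n"
    unfolding M_def by (intro minus_carrier_mat smult_carrier_mat one_carrier_mat)
  have Mx: "M *\<^sub>v x = A *\<^sub>v x - k \<cdot>\<^sub>v x" if "x \<in> carrier_vec n" for x
  proof -
    have "(k \<cdot>\<^sub>m 1\<^sub>m n) *\<^sub>v x = k \<cdot>\<^sub>v x"
      using that by (intro eq_vecI) auto
    then show ?thesis
      using A that unfolding M_def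
      by (subst minus_mult_distrib_mat_vec[where nr = n and nc = n]) auto
  qed
  have xMx: "x \<bullet> (M *\<^sub>v x) = x \<bullet> (A *\<^sub>v x) - k * (x \<bullet> x)" if "x \<in> carrier_vec n" for x
    using A that by (simp add: Mx scalar_prod_minus_distrib[where n = n])
  have "transpose_mat M = M"
  proof (rule eq_matI)
    fix i j
    assume "i < dim_row M" "j < dim_col M"
    moreover have "A $$ (j, i) = A $$ (i, j)" if "i < n" "j < n"
      using arg_cong[OF sym, of "\<lambda>X. X $$ (i, j)"] A that by simp
    ultimately show "transpose_mat M $$ (i, j) = M $$ (i, j)"
      using A by (auto simp: M_def)
  qed (use M in auto)
  then have "M *\<^sub>v v = 0\<^sub>v n"
    using M v bound by (intro psd_mult_vec_eq_0) (auto simp: xMx vAv)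
  have "A *\<^sub>v v = k \<cdot>\<^sub>v v"
  proof (rule eq_vecI)
    fix i
    assume "i < dim_vec (k \<cdot>\<^sub>v v)"
    then show "(A *\<^sub>v v) $ i = (k \<cdot>\<^sub>v v) $ i"
      using arg_cong[OF \<open>M *\<^sub>v v = 0\<^sub>v n\<close>, of "\<lambda>x. x $ i"] A v(1) by (simp add: Mx)
  qed (use A v in auto)
  moreover have "v \<noteq> 0\<^sub>v n"
    using v by auto
  ultimately have "eigenvector A v k"
    using A v by (simp add: eigenvector_def)
  then show ?thesis
    using bound that by blast
qed

text \<open>Testing the bound on an eigenvector for \<open>l\<close> gives \<open>k \<le> l\<close>.
  Finiteness of the spectrum makes \<open>Min\<close> a genuine minimum.\<close>

lemma lambda_min_eqI:
  fixes A :: "real mat"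
  assumes A: "A \<in> carrier_mat n n" and ev: "eigenvector A v k"
    and bound: "\<And>x. x \<in> carrier_vec n \<Longrightarrow> k * (x \<bullet> x) \<le> x \<bullet> (A *\<^sub>v x)"
  shows "lambda_min A = k"
  unfolding lambda_min_def
proof (rule Min_eqI)
  show "finite (spectrum A)"
    using card_finite_spectrum[OF A] by simp
  show "k \<in> spectrum A"
    using ev by (auto simp: spectrum_def eigenvalue_def)
next
  fix l
  assume "l \<in> spectrum A"
  then obtain x where x: "x \<in> carrier_vec n" "x \<noteq> 0\<^sub>v n" "A *\<^sub>v x = l \<cdot>\<^sub>v x"
    using A by (auto simp: spectrum_def eigenvalue_def eigenvector_def)
  then have "k * (x \<bullet> x) \<le> l * (x \<bullet> x)"
    using bound[OF x(1)] by simp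
  then show "k \<le> l"
    using scalar_prod_self_pos[OF x(1,2)] by simp
qed

section \<open>Reflection of vectors and coupling of two mirrored copies\<close>

definition flip_vec :: "'a Matrix.vec \<Rightarrow> 'a Matrix.vec" where
  "flip_vec v = Matrix.vec (dim_vec v) (\<lambda>i. v $ (dim_vec v - Suc i))"

lemma flip_vec_carrier [simp]: "flip_vec v \<in> carrier_vec n \<longleftrightarrow> v \<in> carrier_vec n"
  by (metis carrier_vecD carrier_vecI dim_vec flip_vec_def)

lemma index_flip_vec [simp]: "i < dim_vec v \<Longrightarrow> flip_vec v $ i = v $ (dim_vec v - Suc i)"
  and dim_flip_vec [simp]: "dim_vec (flip_vec v) = dim_vec v"
  by (simp_all add: flip_vec_def)

lemma flip_vec_scalar_prod:
  assumes "a \<in> carrier_vec n" "b \<in> carrier_vec n"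
  shows "flip_vec a \<bullet> flip_vec b = a \<bullet> b"
  using assms sum.nat_diff_reindex[of "\<lambda>i. a $ i * b $ i" n]
  by (simp add: scalar_prod_def atLeast0LessThan)

text \<open>The assumption \<open>flip\<close> says that \<open>A\<close> is centrosymmetric: each
  row is the reversal of its mirror row, and reversing both factors preserves a scalar
  product.\<close>

lemma mult_flip_vec:
  assumes A: "A \<in> carrier_mat n n" and v: "v \<in> carrier_vec n"
    and flip: "\<And>i j. i < n \<Longrightarrow> j < n \<Longrightarrow> A $$ (n - Suc i, n - Suc j) = A $$ (i, j)"
  shows "A *\<^sub>v flip_vec v = flip_vec (A *\<^sub>v v)"
proof (rule eq_vecI)
  fix i
  assume "i < dim_vec (flip_vec (A *\<^sub>v v))"
  then have i: "i < n"
    using A by simp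
  have "row A i = flip_vec (row A (n - Suc i))"
    using A i flip[of "n - Suc i"] flip[OF i]
    by (intro eq_vecI) (auto simp: Suc_diff_Suc)
  then show "(A *\<^sub>v flip_vec v) $ i = flip_vec (A *\<^sub>v v) $ i"
    using A i flip_vec_scalar_prod[OF row_carrier_vec[OF _ A] v, of "n - Suc i"] by simp
qed (use A in auto)

lemma mult_vec_rank_one:
  fixes u :: "'a :: comm_semiring_0 Matrix.vec"
  assumes "u \<in> carrier_vec m" "x \<in> carrier_vec m"
  shows "Matrix.mat m m (\<lambda>(i, j). u $ i * u $ j) *\<^sub>v x = (u \<bullet> x) \<cdot>\<^sub>v u"
  using assms
  by (intro eq_vecI) (auto simp: scalar_prod_def sum_distrib_left ac_simps intro!: sum.cong)

text \<open>The cutting argument in abstract form, with the cut edge as the rank-one term of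
  \<open>u\<close>. Its form \<open>(u \<bullet> x)\<^sup>2\<close> is nonnegative, so the lower
  bound survives. On a vector followed by its mirror image the two halves of \<open>u\<close>
  contribute opposite amounts, so the term vanishes there and the eigenvalue persists.\<close>

lemma lambda_min_mirror_coupling:
  fixes A :: "real mat"
  assumes A: "A \<in> carrier_mat n n" and "0 < n" and sym: "transpose_mat A = A"
    and flip: "\<And>i j. i < n \<Longrightarrow> j < n \<Longrightarrow> A $$ (n - Suc i, n - Suc j) = A $$ (i, j)"
    and a: "a \<in> carrier_vec n"
  defines "u \<equiv> a @\<^sub>v - flip_vec a"
  shows "lambda_min (four_block_mat A (0\<^sub>m n n) (0\<^sub>m n n) A +
      Matrix.mat (n + n) (n + n) (\<lambda>(i, j). u $ i * u $ j)) = lambda_min A"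
proof -
  let ?D = "four_block_mat A (0\<^sub>m n n) (0\<^sub>m n n) A"
  let ?R = "Matrix.mat (n + n) (n + n) (\<lambda>(i, j). u $ i * u $ j)"
  obtain v k where ev: "eigenvector A v k"
    and bound: "\<And>x. x \<in> carrier_vec n \<Longrightarrow> k * (x \<bullet> x) \<le> x \<bullet> (A *\<^sub>v x)"
    using rayleigh_minimum[OF A \<open>0 < n\<close> sym] by blast
  have v: "v \<in> carrier_vec n" "v \<noteq> 0\<^sub>v n" "A *\<^sub>v v = k \<cdot>\<^sub>v v"
    using ev A by (auto simp: eigenvector_def)
  have D: "?D \<in> carrier_mat (n + n) (n + n)"
    using A by simp
  have u: "u \<in> carrier_vec (n + n)"
    using a by (simp add: u_def)
  have mult: "(?D + ?R) *\<^sub>v (y @\<^sub>v z) =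
      (A *\<^sub>v y @\<^sub>v A *\<^sub>v z) + (u \<bullet> (y @\<^sub>v z)) \<cdot>\<^sub>v u"
    if "y \<in> carrier_vec n" "z \<in> carrier_vec n" for y z
  proof -
    have yz: "y @\<^sub>v z \<in> carrier_vec (n + n)"
      using that by simp
    have "(?D + ?R) *\<^sub>v (y @\<^sub>v z) = ?D *\<^sub>v (y @\<^sub>v z) + ?R *\<^sub>v (y @\<^sub>v z)"
      by (rule add_mult_distrib_mat_vec[OF D _ yz]) simp
    then show ?thesis
      using mult_mat_vec_split[OF A A that] mult_vec_rank_one[OF u yz] by simp
  qed
  have "lambda_min (?D + ?R) = k"
  proof (rule lambda_min_eqI)
    show "?D + ?R \<in> carrier_mat (n + n) (n + n)"
      using D by simp
    have "u \<bullet> (v @\<^sub>v flip_vec v) = a \<bullet> v + (- flip_vec a) \<bullet> flip_vec v"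
      using a v unfolding u_def by (intro scalar_prod_append) auto
    also have "\<dots> = 0"
      using a v by (simp add: flip_vec_scalar_prod[where n = n])
    finally have "u \<bullet> (v @\<^sub>v flip_vec v) = 0" .
    moreover have "A *\<^sub>v flip_vec v = k \<cdot>\<^sub>v flip_vec v"
      using mult_flip_vec[OF A v(1) flip] v by (auto simp: flip_vec_def)
    ultimately have "(?D + ?R) *\<^sub>v (v @\<^sub>v flip_vec v) = k \<cdot>\<^sub>v (v @\<^sub>v flip_vec v)"
      using v u by (subst mult) (auto simp: append_vec_def Let_def)
    moreover have "v @\<^sub>v flip_vec v \<noteq> 0\<^sub>v (n + n)"
    proof
      assume eq: "v @\<^sub>v flip_vec v = 0\<^sub>v (n + n)"
      have "v $ i = 0" if "i < n" for i
        using arg_cong[OF eq, of "\<lambda>x. x $ i"] v(1) that by simp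
      then show False
        using v by auto
    qed
    ultimately show "eigenvector (?D + ?R) (v @\<^sub>v flip_vec v) k"
      using v A by (simp add: eigenvector_def)
  next
    fix x :: "real Matrix.vec"
    assume x: "x \<in> carrier_vec (n + n)"
    define y z where "y = vec_first x n" and "z = vec_last x n"
    have yz: "y \<in> carrier_vec n" "z \<in> carrier_vec n" "x = y @\<^sub>v z"
      using x by (auto simp: y_def z_def)
    have "x \<bullet> ((?D + ?R) *\<^sub>v x) =
        x \<bullet> (A *\<^sub>v y @\<^sub>v A *\<^sub>v z) + x \<bullet> ((u \<bullet> x) \<cdot>\<^sub>v u)"
      using x A yz u mult[OF yz(1,2)] by (simp add: scalar_prod_add_distrib[where n = "n + n"])
    also have "\<dots> = y \<bullet> (A *\<^sub>v y) + z \<bullet> (A *\<^sub>v z) + (u \<bullet> x)\<^sup>2"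
      using A x u yz scalar_prod_append[of y n z n "A *\<^sub>v y" "A *\<^sub>v z"]
        comm_scalar_prod[OF x u] by (simp add: power2_eq_square)
    finally have "x \<bullet> ((?D + ?R) *\<^sub>v x) = y \<bullet> (A *\<^sub>v y) + z \<bullet> (A *\<^sub>v z) + (u \<bullet> x)\<^sup>2" .
    moreover have "x \<bullet> x = y \<bullet> y + z \<bullet> z"
      using yz scalar_prod_append[OF yz(1,2) yz(1,2)] by simp
    ultimately show "k * (x \<bullet> x) \<le> x \<bullet> ((?D + ?R) *\<^sub>v x)"
      using bound[OF yz(1)] bound[OF yz(2)] by (simp add: algebra_simps add_mono add_increasing2)
  qed
  then show ?thesis
    using lambda_min_eqI[OF A ev bound] by simp
qed

section \<open>Entries of the path Laplacian and of the perturbation\<close>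

lemma path_degree:
  assumes "i < m"
  shows "card {k. path_adj m i k} = (if 0 < i then 1 else 0) + (if Suc i < m then 1 else 0)"
proof -
  have "{k. path_adj m i k} = (if 0 < i then {i - 1} else {}) \<union> (if Suc i < m then {Suc i} else {})"
    using assms by (auto simp: path_adj_def)
  then show ?thesis
    by auto
qed

text \<open>One summand per neighbour on the diagonal covers \<open>m = 1\<close> as well, where the
  degree is 0, and shows directly what cutting an edge changes.\<close>

lemma index_path_laplacian:
  assumes "i < m" "j < m"
  shows "path_laplacian m $$ (i, j) =
    (if i = j then (if 0 < i then 1 else 0) + (if Suc i < m then 1 else 0)
     else if j = Suc i \<or> i = Suc j then - 1 else 0)"
  using assms by (simp add: path_laplacian_def path_degree) (simp add: path_adj_def)

text \<open>The term \<open>c i * c j\<close> is the Laplacian of the single middle edge joining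
  \<open>n - 1\<close> and \<open>n\<close>: it restores 1 to the degrees of both endpoints and the
  entry -1 between them.\<close>

lemma index_path_laplacian_double:
  fixes n i j :: nat
  assumes "0 < n" "i < n + n" "j < n + n"
  defines "c \<equiv> \<lambda>i. if i = n - 1 then 1 else if i = n then - 1 else (0 :: real)"
  shows "path_laplacian (n + n) $$ (i, j) =
    (if i < n then if j < n then path_laplacian n $$ (i, j) else 0
     else if j < n then 0 else path_laplacian n $$ (i - n, j - n)) + c i * c j"
proof -
  obtain m where m: "n = Suc m"
    using assms(1) by (cases n) auto
  \<comment> \<open>The four blocks; indices in the second half are written as offsets from
    \<open>n\<close>.\<close>
  consider "i < n" "j < n" | j' where "i < n" "j = n + j'" | i' where "i = n + i'" "j < n"
    | i' j' where "i = n + i'" "j = n + j'"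
    by (metis le_add_diff_inverse not_less)
  then show ?thesis
  proof cases
    case 1
    then show ?thesis
      by (auto simp: index_path_laplacian c_def m)
  next
    case 2
    then show ?thesis
      using assms(3) by (auto simp: index_path_laplacian c_def m)
  next
    case 3
    then show ?thesis
      using assms(2) by (auto simp: index_path_laplacian c_def m)
  next
    case 4
    then show ?thesis
      using assms(2,3) by (auto simp: index_path_laplacian c_def m)
  qed
qed

lemma path_laplacian_symmetries:
  assumes "i < m" "j < m"
  shows "path_laplacian m $$ (j, i) = path_laplacian m $$ (i, j)"
    and "path_laplacian m $$ (m - Suc i, m - Suc j) = path_laplacian m $$ (i, j)"
proof -
  show "path_laplacian m $$ (j, i) = path_laplacian m $$ (i, j)"
    using assms by (auto simp: index_path_laplacian)
  \<comment> \<open>How each test in the entry formula transforms under the reflection, which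
    reverses edges and swaps the two ends of the path.\<close>
  have "m - Suc i = m - Suc j \<longleftrightarrow> i = j" "m - Suc j = Suc (m - Suc i) \<longleftrightarrow> i = Suc j"
    "m - Suc i = Suc (m - Suc j) \<longleftrightarrow> j = Suc i" "0 < m - Suc i \<longleftrightarrow> Suc i < m"
    "Suc (m - Suc i) < m \<longleftrightarrow> 0 < i" "m - Suc i < m" "m - Suc j < m"
    using assms by linarith+
  then show "path_laplacian m $$ (m - Suc i, m - Suc j) = path_laplacian m $$ (i, j)"
    using assms by (auto simp: index_path_laplacian)
qed

lemma std_basis_col_outer:
  assumes "j - 1 < m"
  shows "std_basis_col m j * transpose_mat (std_basis_col m j) =
    Matrix.mat m m (\<lambda>(i, k). if i = j - 1 \<and> k = j - 1 then 1 else 0)"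
proof -
  have "std_basis_col m j $$ (i, 0) = (if i = j - 1 then 1 else 0)" if "i < m" for i
    using assms that by (simp add: std_basis_col_def mat_of_cols_index)
  moreover have "std_basis_col m j \<in> carrier_mat m 1"
    using mat_of_cols_carrier(1)[of m "[unit_vec m (j - 1)]"] by (simp add: std_basis_col_def)
  ultimately show ?thesis
    by (intro eq_matI) (simp_all add: scalar_prod_def)
qed

theorem theorem7:
  fixes n :: nat and \<epsilon> :: real
  assumes "odd n" and "\<epsilon> > 0"
  shows "lambda_min (path_laplacian_centered n \<epsilon>) = lambda_min (path_laplacian_two_centers n \<epsilon>)"
proof -
  obtain p where n: "n = 2 * p + 1"
    using assms(1) by (auto elim: oddE)
  define A where "A = path_laplacian_centered n \<epsilon>"
  \<comment> \<open>Counted from 0, both centres of the long path sit at offset \<open>p\<close> in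
    their half.\<close>
  have pos: "(n + 1) div 2 - 1 = p" "(2 * n + 2) div 4 - 1 = p" "(6 * n + 2) div 4 - 1 = n + p"
    using n by auto
  have L: "path_laplacian m \<in> carrier_mat m m" for m
    by (simp add: path_laplacian_def)
  have p: "p < n" "p < 2 * n" "n + p < 2 * n"
    using n by auto
  have A_eq: "A = path_laplacian n + \<epsilon> \<cdot>\<^sub>m Matrix.mat n n (\<lambda>(i, j). if i = p \<and> j = p then 1 else 0)"
    unfolding A_def path_laplacian_centered_def Let_def
    by (subst std_basis_col_outer) (simp_all only: pos p)
  have A: "A \<in> carrier_mat n n"
    using L[of n] by (simp add: A_eq)
  have idx: "A $$ (i, j) = path_laplacian n $$ (i, j) + (if i = p \<and> j = p then \<epsilon> else 0)"
    if "i < n" "j < n" for i j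
    using that L[of n] by (simp add: A_eq)
  \<comment> \<open>The last vertex of the first half; its mirror image is the first vertex of the
    second half, so \<open>u\<close> is the signed incidence vector of the middle edge.\<close>
  define a :: "real Matrix.vec" where "a = unit_vec n (n - 1)"
  define u where "u = a @\<^sub>v - flip_vec a"
  have u: "u $ i = (if i = n - 1 then 1 else if i = n then - 1 else 0)" if "i < n + n" for i
    using that n by (auto simp: u_def a_def)
  have B_eq: "path_laplacian_two_centers n \<epsilon> = path_laplacian (2 * n) +
      \<epsilon> \<cdot>\<^sub>m (Matrix.mat (2 * n) (2 * n) (\<lambda>(i, j). if i = p \<and> j = p then 1 else 0) +
        Matrix.mat (2 * n) (2 * n) (\<lambda>(i, j). if i = n + p \<and> j = n + p then 1 else 0))"
    unfolding path_laplacian_two_centers_def Let_def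
    by (subst (1 2) std_basis_col_outer) (simp_all only: pos p)
  have "path_laplacian_two_centers n \<epsilon> = four_block_mat A (0\<^sub>m n n) (0\<^sub>m n n) A +
      Matrix.mat (n + n) (n + n) (\<lambda>(i, j). u $ i * u $ j)" (is "?B = ?C")
  proof (rule eq_matI)
    fix i j
    assume "i < dim_row ?C" "j < dim_col ?C"
    then have ij: "i < n + n" "j < n + n"
      by auto
    have B: "?B $$ (i, j) = path_laplacian (2 * n) $$ (i, j) +
        (if i = p \<and> j = p \<or> i = n + p \<and> j = n + p then \<epsilon> else 0)"
      using ij p L[of "2 * n"] by (simp add: B_eq)
    have C: "?C $$ (i, j) =
        (if i < n then if j < n then A $$ (i, j) else 0
         else if j < n then 0 else A $$ (i - n, j - n)) + u $ i * u $ j"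
      using ij A by simp
    have double: "path_laplacian (2 * n) $$ (i, j) =
        (if i < n then if j < n then path_laplacian n $$ (i, j) else 0
         else if j < n then 0 else path_laplacian n $$ (i - n, j - n)) + u $ i * u $ j"
      using index_path_laplacian_double[of n i j] ij p(1) unfolding u[OF ij(1)] u[OF ij(2)] mult_2
      by blast
    \<comment> \<open>The edge terms agree, and each perturbation lies in one diagonal block, where
      it is the perturbation contained in \<open>A\<close>.\<close>
    show "?B $$ (i, j) = ?C $$ (i, j)"
      unfolding B C double using ij p(1) by (auto simp: idx)
  qed (use A L[of "2 * n"] in \<open>auto simp: B_eq\<close>)
  moreover have "transpose_mat A = A"
    using A by (intro eq_matI) (auto simp: idx path_laplacian_symmetries(1))
  \<comment> \<open>Since \<open>n = 2 * p + 1\<close>, the reflection fixes the centre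
    \<open>p\<close>, so the perturbation is invariant along with the Laplacian.\<close>
  moreover have "A $$ (n - Suc i, n - Suc j) = A $$ (i, j)" if "i < n" "j < n" for i j
  proof -
    have "n - Suc i < n" "n - Suc j < n" "n - Suc i = p \<longleftrightarrow> i = p" "n - Suc j = p \<longleftrightarrow> j = p"
      using that n by auto
    then show ?thesis
      using that by (simp add: idx path_laplacian_symmetries(2))
  qed
  ultimately show ?thesis
    using lambda_min_mirror_coupling[OF A, of a] n by (simp add: A_def a_def u_def)
qed

end
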